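(* Let $D$ be a half-factorial domain (HFD) such that every atom of $D$ is a good atom of the polynomial ring $D[X]$. Then $D[X]$ is an HFD.
   Context: Domain means (commutative) integral domain; $D[X]$ is the polynomial ring in one indeterminate over $D$. An atom (irreducible element) of a domain $A$ is a nonzero nonunit that is not a product of two nonunits of $A$. $A$ is atomic if every nonzero nonunit of $A$ is a product of finitely many atoms. $A$ is a half-factorial domain (HFD) if $A$ is atomic and, for each nonzero nonunit $x\in A$, all factorizations of $x$ into atoms have the same length (number of factors). Let $A$ be a domain (the notions below are used for atomic $A$; here $A=D[X]$, which is atomic when $D$ is an HFD). An atomic equality is an equality $a_1\cdots a_n=b_1\cdots b_m$ in which all factors $a_i,b_j$ are atoms of $A$ ($n,m\ge 1$). It is balanced if $n=m$ and unbalanced if $n\ne m$. It is irredundant if no proper subproduct of the $a$'s is associated to a proper subproduct of the $b$'s, i.e. $\prod_{i\in I}a_i$ is not associated (equal up to a unit factor of $A$) to $\prod_{j\in J}b_j$ for all nonempty proper subsets $I\subsetneq\{1,\dots,n\}$, $J\subsetneq\{1,\dots,m\}$. A bad atom of $A$ is an atom that appears (as one of the $a_i$ or $b_j$) in some irredundant unbalanced atomic equality. A good atom of $A$ is an atom that is not bad. *)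

theory Defs
  imports "HOL-Computational_Algebra.Computational_Algebra"
begin

text \<open>
  An atom is an element satisfying the library predicate \<^const>\<open>irreducible\<close>, and
  \<open>x dvd 1\<close> says that \<open>x\<close> is a unit. The order of factors is immaterial, so a product
  \<open>a\<^sub>1 \<cdots> a\<^sub>n\<close> of atoms is given by the multiset of its factors; the number of factors,
  counted with repetition, is the \<^const>\<open>size\<close> of the multiset.
\<close>

definition atomic_factorization :: "'a::idom multiset \<Rightarrow> 'a \<Rightarrow> bool" where
  "atomic_factorization F x \<longleftrightarrow> (\<forall>a\<in>#F. irreducible a) \<and> prod_mset F = x"

text \<open>
  Properties of a whole domain are predicates on a type of class \<^class>\<open>idom\<close>.
\<close>

definition atomic_domain :: "'a::idom itself \<Rightarrow> bool" where
  "atomic_domain _ \<longleftrightarrow>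
     (\<forall>x::'a. x \<noteq> 0 \<and> \<not> x dvd 1 \<longrightarrow> (\<exists>F. atomic_factorization F x))"

definition half_factorial_domain :: "'a::idom itself \<Rightarrow> bool" where
  "half_factorial_domain T \<longleftrightarrow>
     atomic_domain T \<and>
     (\<forall>x::'a. x \<noteq> 0 \<and> \<not> x dvd 1 \<longrightarrow>
        (\<forall>F G. atomic_factorization F x \<and> atomic_factorization G x \<longrightarrow> size F = size G))"

definition associates :: "'a::idom \<Rightarrow> 'a \<Rightarrow> bool" where
  "associates x y \<longleftrightarrow> (\<exists>u. u dvd 1 \<and> x = u * y)"

definition atomic_equality :: "'a::idom multiset \<Rightarrow> 'a multiset \<Rightarrow> bool" where
  "atomic_equality A B \<longleftrightarrow>
     A \<noteq> {#} \<and> B \<noteq> {#} \<and>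
     (\<forall>a\<in>#A. irreducible a) \<and> (\<forall>b\<in>#B. irreducible b) \<and>
     prod_mset A = prod_mset B"

definition balanced :: "'a::idom multiset \<Rightarrow> 'a multiset \<Rightarrow> bool" where
  "balanced A B \<longleftrightarrow> size A = size B"

text \<open>
  The nonempty proper submultisets of \<open>A\<close> are the families \<open>(a\<^sub>i)\<close>, \<open>i \<in> I\<close>, for
  nonempty proper sets \<open>I\<close> of indices, even when \<open>A\<close> has repeated elements.
\<close>

definition irredundant :: "'a::idom multiset \<Rightarrow> 'a multiset \<Rightarrow> bool" where
  "irredundant A B \<longleftrightarrow>
     (\<forall>S T. S \<noteq> {#} \<and> S \<subset># A \<and> T \<noteq> {#} \<and> T \<subset># B \<longrightarrow>
        \<not> associates (prod_mset S) (prod_mset T))"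

definition bad_atom :: "'a::idom \<Rightarrow> bool" where
  "bad_atom a \<longleftrightarrow>
     irreducible a \<and>
     (\<exists>A B. atomic_equality A B \<and> \<not> balanced A B \<and> irredundant A B \<and> (a \<in># A \<or> a \<in># B))"

definition good_atom :: "'a::idom \<Rightarrow> bool" where
  "good_atom a \<longleftrightarrow> irreducible a \<and> \<not> bad_atom a"

end

theory Submission
  imports Defs
begin

text \<open>
  An atomic equality that is not irredundant splits into two shorter ones, so every atomic equality
  is composed of irredundant ones, and an unbalanced component contains no good atom. If all factors
  on one side but one are good, then a component containing a good atom is balanced, and the only
  other component can be the remaining atom alone, which equals a single atom. Hence, for \<open>d \<in> D\<close>
  with \<open>n\<close> atomic factors and an atom \<open>f\<close> of \<open>D[X]\<close>, every factorization of \<open>d f\<close> in \<open>D[X]\<close> has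
  length \<open>n + 1\<close>.

  Let \<open>K\<close> be the quotient field of \<open>D\<close>. Factoring over \<open>K\<close> and clearing denominators gives
  \<open>d f = c p\<^sub>1 \<cdots> p\<^sub>k\<close> with \<open>c, d \<in> D\<close> and atoms \<open>p\<^sub>i\<close> of \<open>D[X]\<close> that are irreducible over \<open>K\<close>.
  By unique factorization in \<open>K[X]\<close>, the \<open>p\<^sub>i\<close> are determined up to relations \<open>a p = b q\<close> with
  \<open>a, b \<in> D\<close>, and in these \<open>a\<close> and \<open>b\<close> have the same length. So \<open>k\<close> plus the length of \<open>c\<close> minus
  the length of \<open>d\<close> depends only on \<open>f\<close>; it is additive in \<open>f\<close> and equals \<open>1\<close> on atoms.
\<close>

section \<open>Units and products of atoms in a domain\<close>

text \<open>The library has this fact (as \<open>is_unit_mult_iff\<close>) only for types with a division operation.\<close>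

lemma idom_unit_mult_iff:
  fixes a b :: "'a::idom"
  shows "a * b dvd 1 \<longleftrightarrow> a dvd 1 \<and> b dvd 1"
  using mult_dvd_mono[of a 1 b 1] by (auto dest: dvd_mult_left dvd_mult_right)

lemma irreducible_unit_mult:
  fixes a u :: "'a::idom"
  assumes "irreducible a" "u dvd 1"
  shows "irreducible (u * a)"
proof -
  obtain v where v: "u * v = 1"
    using assms(2) by (metis dvdE)
  show ?thesis
  proof (rule irreducibleI)
    show "u * a \<noteq> 0"
      using assms(1) v by (auto simp: irreducible_def)
    show "\<not> u * a dvd 1"
      using assms(1) by (auto simp: irreducible_def dest: dvd_mult_right)
    fix b c assume bc: "u * a = b * c"
    have "a = (v * b) * c"
      using v bc by (metis mult.assoc mult.commute mult_1)
    then have "v * b dvd 1 \<or> c dvd 1"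
      using assms(1) irreducibleD by blast
    then show "b dvd 1 \<or> c dvd 1"
      by (auto dest: dvd_mult_right)
  qed
qed

text \<open>The unit goes into one chosen atom, so an equality up to units becomes a genuine
  equality of products with the same lengths. The empty product has no atom to take it.\<close>

lemma irreducibles_absorb_unit:
  fixes u :: "'a::idom"
  assumes "A \<noteq> {#}" "\<forall>a\<in>#A. irreducible a" "u dvd 1"
  obtains A' where "size A' = size A" "A' \<noteq> {#}" "\<forall>a\<in>#A'. irreducible a"
    "prod_mset A' = u * prod_mset A"
proof -
  obtain a B where A: "A = add_mset a B"
    using assms(1) by (meson multiset_cases)
  have "irreducible (u * a)"
    using assms A by (intro irreducible_unit_mult) auto
  then show ?thesis
    using that[of "add_mset (u * a) B"] assms(2) A by (auto simp: mult.assoc)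
qed

lemma irreducible_prod_mset_nonzero:
  "\<forall>a\<in>#A. irreducible a \<Longrightarrow> prod_mset A \<noteq> (0::'a::idom)"
  by (auto simp: prod_mset_zero_iff irreducible_def)

lemma irreducible_prod_mset_unit_iff:
  "\<forall>a\<in>#A. irreducible a \<Longrightarrow> prod_mset A dvd (1::'a::idom) \<longleftrightarrow> A = {#}"
  by (induction A) (auto simp: irreducible_def idom_unit_mult_iff)

lemma size_eq_1_if_irreducible_prod_mset:
  fixes A :: "'a::idom multiset"
  assumes "\<forall>a\<in>#A. irreducible a" "irreducible (prod_mset A)"
  shows "size A = 1"
proof (cases A)
  case empty
  then show ?thesis using assms by (auto simp: irreducible_def)
next
  case (add a B)
  have "a dvd 1 \<or> prod_mset B dvd 1"
    using assms(2) irreducibleD add by fastforce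
  then have "B = {#}"
    using assms(1) add irreducible_prod_mset_unit_iff[of B] by (auto simp: irreducible_def)
  then show ?thesis using add by simp
qed

section \<open>Factorization length in a half-factorial domain\<close>

text \<open>At \<open>0\<close> the length is a junk value.\<close>

definition flen :: "'a::idom \<Rightarrow> nat" where
  "flen x = (SOME n. \<exists>u F. u dvd 1 \<and> (\<forall>a\<in>#F. irreducible a) \<and> x = u * prod_mset F \<and> size F = n)"

lemma HFD_factorization:
  fixes x :: "'a::idom"
  assumes "half_factorial_domain TYPE('a)" "x \<noteq> 0"
  obtains u F where "u dvd 1" "\<forall>a\<in>#F. irreducible a" "x = u * prod_mset F"
proof (cases "x dvd 1")
  case True
  then show ?thesis using that[of x "{#}"] by simp
next
  case False
  then obtain F where "atomic_factorization F x"
    using assms by (auto simp: half_factorial_domain_def atomic_domain_def)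
  then show ?thesis using that[of 1 F] by (auto simp: atomic_factorization_def)
qed

text \<open>Each unit is absorbed into an atom on its side, which leaves two factorizations of the
  same nonunit. If one side has no atoms, the common value is a unit and the other side has none
  either.\<close>

lemma HFD_length_unique:
  fixes F G :: "'a::idom multiset"
  assumes "half_factorial_domain TYPE('a)" "u dvd 1" "v dvd 1"
    "\<forall>a\<in>#F. irreducible a" "\<forall>a\<in>#G. irreducible a" "u * prod_mset F = v * prod_mset G"
  shows "size F = size G"
proof (cases "F = {#} \<or> G = {#}")
  case True
  have "prod_mset F dvd 1 \<longleftrightarrow> prod_mset G dvd 1"
    using assms(2,3,6) by (metis idom_unit_mult_iff)
  with True show ?thesis
    using irreducible_prod_mset_unit_iff[OF assms(4)] irreducible_prod_mset_unit_iff[OF assms(5)]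
    by auto
next
  case False
  obtain F' where F': "size F' = size F" "F' \<noteq> {#}" "\<forall>a\<in>#F'. irreducible a"
    "prod_mset F' = u * prod_mset F"
    using irreducibles_absorb_unit False assms by metis
  obtain G' where G': "size G' = size G" "\<forall>a\<in>#G'. irreducible a"
    "prod_mset G' = v * prod_mset G"
    using irreducibles_absorb_unit False assms by metis
  have "prod_mset F' \<noteq> 0" "\<not> prod_mset F' dvd 1"
    using F' irreducible_prod_mset_nonzero irreducible_prod_mset_unit_iff by metis+
  moreover have "atomic_factorization F' (prod_mset F')" "atomic_factorization G' (prod_mset F')"
    using F' G' assms(6) by (auto simp: atomic_factorization_def)
  ultimately show ?thesis
    using assms(1) F'(1) G'(1) unfolding half_factorial_domain_def by metis
qed

lemma flen_eq:
  fixes F :: "'a::idom multiset"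
  assumes "half_factorial_domain TYPE('a)" "u dvd 1" "\<forall>a\<in>#F. irreducible a"
  shows "flen (u * prod_mset F) = size F"
  unfolding flen_def
proof (rule some_equality)
  show "\<exists>v G. v dvd 1 \<and> (\<forall>a\<in>#G. irreducible a) \<and> u * prod_mset F = v * prod_mset G \<and> size G = size F"
    using assms by blast
next
  fix n
  assume "\<exists>v G. v dvd 1 \<and> (\<forall>a\<in>#G. irreducible a) \<and> u * prod_mset F = v * prod_mset G \<and> size G = n"
  then obtain v G where G: "v dvd 1" "\<forall>a\<in>#G. irreducible a"
    "u * prod_mset F = v * prod_mset G" "size G = n"
    by blast
  then show "n = size F"
    using HFD_length_unique[OF assms(1,2) G(1) assms(3) G(2,3)] by simp
qed

lemma flen_mult:
  fixes x y :: "'a::idom"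
  assumes "half_factorial_domain TYPE('a)" "x \<noteq> 0" "y \<noteq> 0"
  shows "flen (x * y) = flen x + flen y"
proof -
  obtain u F where F: "u dvd 1" "\<forall>a\<in>#F. irreducible a" "x = u * prod_mset F"
    using HFD_factorization assms by metis
  obtain v G where G: "v dvd 1" "\<forall>a\<in>#G. irreducible a" "y = v * prod_mset G"
    using HFD_factorization assms by metis
  have "x * y = (u * v) * prod_mset (F + G)"
    using F G by (simp add: algebra_simps)
  moreover have "u * v dvd 1" "\<forall>a\<in>#F + G. irreducible a"
    using F G by (auto simp: idom_unit_mult_iff)
  ultimately have "flen (x * y) = size (F + G)"
    using flen_eq[OF assms(1)] by metis
  then show ?thesis
    using F G flen_eq[OF assms(1)] by simp
qed

lemma flen_eq_0_imp_unit:
  fixes x :: "'a::idom"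
  assumes "half_factorial_domain TYPE('a)" "x \<noteq> 0" "flen x = 0"
  shows "x dvd 1"
proof -
  obtain u F where F: "u dvd 1" "\<forall>a\<in>#F. irreducible a" "x = u * prod_mset F"
    using HFD_factorization assms by metis
  then have "F = {#}"
    using flen_eq[OF assms(1)] assms(3) by fastforce
  then show ?thesis using F by simp
qed

text \<open>The weight \<^term>\<open>degree f + flen (lead_coeff f)\<close> is additive and vanishes only at units.\<close>

lemma HFD_imp_atomic_poly:
  assumes hfd: "half_factorial_domain TYPE('a::idom)"
  shows "atomic_domain TYPE('a poly)"
proof -
  have "\<exists>F. atomic_factorization F f" if "f \<noteq> 0" "\<not> f dvd 1" for f :: "'a poly"
    using that
  proof (induction "degree f + flen (lead_coeff f)" arbitrary: f rule: less_induct)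
    case less
    show ?case
    proof (cases "irreducible f")
      case True
      then show ?thesis by (intro exI[of _ "{#f#}"]) (simp add: atomic_factorization_def)
    next
      case False
      then obtain g h where f: "f = g * h" and gh: "\<not> g dvd 1" "\<not> h dvd 1"
        using less.prems irreducibleI by blast
      have nz: "g \<noteq> 0" "h \<noteq> 0"
        using f less.prems by auto
      have pos: "degree p + flen (lead_coeff p) > 0" if "p \<noteq> 0" "\<not> p dvd 1" for p :: "'a poly"
      proof (rule ccontr)
        assume "\<not> ?thesis"
        then have "degree p = 0" and "flen (lead_coeff p) = 0"
          by auto
        then obtain c where c: "p = [:c:]"
          by (auto elim: degree_eq_zeroE)
        then have "c dvd 1"
          using \<open>flen (lead_coeff p) = 0\<close> flen_eq_0_imp_unit[OF hfd, of c] that by auto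
        then show False
          using that c by (simp add: is_unit_const_poly_iff)
      qed
      have "flen (lead_coeff (g * h)) = flen (lead_coeff g) + flen (lead_coeff h)"
        unfolding lead_coeff_mult using nz by (intro flen_mult[OF hfd]) auto
      then have "degree f + flen (lead_coeff f) =
          (degree g + flen (lead_coeff g)) + (degree h + flen (lead_coeff h))"
        using degree_mult_eq[OF nz] unfolding f by linarith
      then obtain G H where "atomic_factorization G g" "atomic_factorization H h"
        using less.hyps[of g] less.hyps[of h] pos[of g] pos[of h] nz gh by auto
      then have "atomic_factorization (G + H) f"
        using f by (auto simp: atomic_factorization_def)
      then show ?thesis by blast
    qed
  qed
  then show ?thesis
    by (auto simp: atomic_domain_def)
qed

section \<open>Atomic equalities with at most one bad factor on one side\<close>

text \<open>Induction on \<open>size A\<close>: both parts of a redundant equality inherit the bound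
  on \<open>A\<close>, while \<open>B\<close> may contain any number of bad atoms.\<close>

lemma at_most_one_bad_imp_balanced:
  fixes A B :: "'a::idom multiset"
  assumes "atomic_equality A B" "size (filter_mset (\<lambda>a. \<not> good_atom a) A) \<le> 1"
  shows "size A = size B"
  using assms
proof (induction "size A" arbitrary: A B rule: less_induct)
  case less
  have A: "A \<noteq> {#}" "B \<noteq> {#}" "\<forall>a\<in>#A. irreducible a" "\<forall>b\<in>#B. irreducible b"
    "prod_mset A = prod_mset B"
    using less.prems(1) by (auto simp: atomic_equality_def)
  show ?case
  proof (cases "irredundant A B")
    case True
    show ?thesis
    proof (rule ccontr)
      assume ne: "size A \<noteq> size B"
      \<comment> \<open>All of \<open>A\<close> is bad here, so the bound leaves a single atom;
        \<open>B\<close>, whose product is this atom, then has size 1 as well.\<close>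
      have "bad_atom a" if "a \<in># A" for a
        using ne True less.prems(1) A(3) that unfolding bad_atom_def balanced_def by blast
      then have "filter_mset (\<lambda>a. \<not> good_atom a) A = A"
        by (intro filter_mset_eq_conv[THEN iffD2]) (auto simp: good_atom_def)
      then have "size A \<le> 1"
        using less.prems(2) by simp
      then have sA: "size A = 1"
        using A(1) by (cases A) auto
      then obtain a where "A = {#a#}"
        using size_1_singleton_mset by blast
      then have "irreducible (prod_mset B)"
        using A(3,5) by simp
      then show False
        using ne sA size_eq_1_if_irreducible_prod_mset[OF A(4)] by simp
    qed
  next
    case False
    then obtain S T where S: "S \<noteq> {#}" "S \<subset># A" and T: "T \<noteq> {#}" "T \<subset># B"
      and "associates (prod_mset S) (prod_mset T)"
      unfolding irredundant_def by blast
    then obtain u where u: "u dvd 1" "prod_mset S = u * prod_mset T"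
      by (auto simp: associates_def)
    then obtain v where v: "u * v = 1"
      by (metis dvdE)
    then have v1: "v dvd 1"
      by (metis dvd_triv_right)
    define S' T' where "S' = A - S" and "T' = B - T"
    have A_eq: "A = S + S'" and B_eq: "B = T + T'"
      using S T by (auto simp: S'_def T'_def subset_mset.less_imp_le)
    have ne: "S' \<noteq> {#}" "T' \<noteq> {#}"
      using S T A_eq B_eq by auto
    have "prod_mset T \<noteq> 0"
      using A B_eq by (intro irreducible_prod_mset_nonzero) auto
    moreover have "prod_mset T * (u * prod_mset S') = prod_mset T * prod_mset T'"
      using A(5) u(2) unfolding A_eq B_eq by (simp add: mult_ac)
    ultimately have "u * prod_mset S' = prod_mset T'"
      by simp
    then have eq': "prod_mset S' = v * prod_mset T'"
      using v by (metis mult.assoc mult.commute mult_1)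
    \<comment> \<open>The two parts are equalities only up to the units \<open>u\<close> and
      \<open>v\<close>. These are absorbed on the right, so the good and bad atoms of
      \<open>S\<close> and \<open>S'\<close> stay as they are.\<close>
    obtain T1 where T1: "size T1 = size T" "T1 \<noteq> {#}" "\<forall>a\<in>#T1. irreducible a"
      "prod_mset T1 = u * prod_mset T"
      using irreducibles_absorb_unit[of T u] T(1) A(4) B_eq u(1) by (metis union_iff)
    obtain T2 where T2: "size T2 = size T'" "T2 \<noteq> {#}" "\<forall>a\<in>#T2. irreducible a"
      "prod_mset T2 = v * prod_mset T'"
      using irreducibles_absorb_unit[of T' v] ne(2) A(4) B_eq v1 by (metis union_iff)
    have "atomic_equality S T1" "atomic_equality S' T2"
      using S(1) ne T1 T2 u eq' A(3) A_eq by (auto simp: atomic_equality_def)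
    moreover have "size S < size A" "size S' < size A"
      using A_eq S(1) ne by (auto simp: nonempty_has_size)
    moreover have "size (filter_mset (\<lambda>a. \<not> good_atom a) S) \<le> 1"
      "size (filter_mset (\<lambda>a. \<not> good_atom a) S') \<le> 1"
      using less.prems(2) unfolding A_eq by auto
    ultimately have "size S = size T1" "size S' = size T2"
      using less.hyps by blast+
    then show ?thesis
      using T1 T2 A_eq B_eq by simp
  qed
qed

section \<open>Constant multiples of an atom\<close>

lemma prod_mset_const_poly:
  "prod_mset (image_mset (\<lambda>a. [:a:]) C) = [:prod_mset C:]"
  by (induction C) (auto simp: one_pCons mult.commute)

text \<open>With \<open>d\<close> and \<open>c\<close> factored into atoms of the base ring, which
  are good as constants, only the factor coming from \<open>f\<close> on the left can be bad. The
  claim says that this equality is balanced.\<close>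

lemma length_smult_irreducible:
  fixes f :: "'a::idom poly"
  assumes hfd: "half_factorial_domain TYPE('a)"
    and good: "\<And>a::'a. irreducible a \<Longrightarrow> good_atom [:a:]"
    and f: "irreducible f" and dc: "d \<noteq> 0" "c \<noteq> 0"
    and P: "\<forall>p\<in>#P. irreducible p"
    and eq: "smult d f = smult c (prod_mset P)"
  shows "flen d + 1 = flen c + size P"
proof -
  obtain u F where F: "u dvd 1" "\<forall>a\<in>#F. irreducible a" "d = u * prod_mset F"
    using HFD_factorization[OF hfd dc(1)] by metis
  obtain v G where G: "v dvd 1" "\<forall>a\<in>#G. irreducible a" "c = v * prod_mset G"
    using HFD_factorization[OF hfd dc(2)] by metis
  obtain v' where v': "v * v' = 1"
    using G(1) by (metis dvdE)
  have w: "[:v' * u:] dvd 1"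
    using v' F(1) by (metis dvd_triv_right is_unit_const_poly_iff idom_unit_mult_iff)
  \<comment> \<open>The units in \<open>d\<close> and \<open>c\<close> are gathered in this one
    factor; \<open>v'\<close> is the inverse of \<open>v\<close>.\<close>
  define f' where "f' = [:v' * u:] * f"
  have f': "irreducible f'"
    unfolding f'_def by (intro irreducible_unit_mult f w)
  define A B where "A = add_mset f' (image_mset (\<lambda>a. [:a:]) F)"
    and "B = image_mset (\<lambda>a. [:a:]) G + P"
  have irr: "\<forall>a\<in>#A. irreducible a" "\<forall>b\<in>#B. irreducible b"
    using f' F(2) G(2) P by (auto simp: A_def B_def irreducible_const_poly_iff)
  have "prod_mset A = smult v' (smult d f)"
    by (simp add: A_def f'_def F(3) prod_mset_const_poly mult_ac)
  also have "\<dots> = smult (v * v') (prod_mset B)"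
    unfolding eq by (simp add: B_def G(3) prod_mset_const_poly mult_ac)
  finally have prod_eq: "prod_mset A = prod_mset B"
    using v' by simp
  have "\<not> prod_mset A dvd 1"
    using irreducible_prod_mset_unit_iff[OF irr(1)] by (simp add: A_def)
  then have "B \<noteq> {#}"
    using prod_eq by auto
  then have "atomic_equality A B"
    using irr prod_eq by (simp add: atomic_equality_def A_def)
  moreover have "filter_mset (\<lambda>a. \<not> good_atom a) (image_mset (\<lambda>a. [:a:]) F) = {#}"
    using good F(2) by auto
  then have "size (filter_mset (\<lambda>a. \<not> good_atom a) A) \<le> 1"
    by (simp add: A_def del: filter_mset_eq_mempty_iff)
  ultimately have "size A = size B"
    by (rule at_most_one_bad_imp_balanced)
  moreover have "flen d = size F" "flen c = size G"
    using F G flen_eq[OF hfd] by auto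
  ultimately show ?thesis
    by (simp add: A_def B_def)
qed

section \<open>Factorization over the quotient field\<close>

lemma degree_fract_poly: "degree (map_poly to_fract f) = degree f"
  by (rule degree_map_poly) auto

lemma smult_fract_poly_clear_denominators:
  fixes r :: "'a::idom fract poly"
  obtains d g where "d \<noteq> 0" "smult (to_fract d) r = map_poly to_fract g"
proof -
  have "\<exists>d g. d \<noteq> 0 \<and> smult (to_fract d) r = map_poly to_fract g"
  proof (induction r)
    case 0
    show ?case by (intro exI[of _ 1] exI[of _ 0]) simp
  next
    case (pCons x r)
    then obtain d g where d: "d \<noteq> 0" "smult (to_fract d) r = map_poly to_fract g"
      by blast
    obtain a b where x: "x = Fract a b" "b \<noteq> 0"
      by (cases x)
    have "smult (to_fract (b * d)) (pCons x r) = map_poly to_fract (pCons (a * d) (smult b g))"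
      using x d(2)[symmetric] by (simp add: map_poly_pCons Fract_conv_to_fract)
    moreover have "b * d \<noteq> 0"
      using x d by simp
    ultimately show ?case by blast
  qed
  then show ?thesis using that by blast
qed

lemma irreducible_fract_poly_degree_pos:
  "irreducible (map_poly to_fract p) \<Longrightarrow> degree p > 0"
  using is_unit_iff_degree[of "map_poly to_fract p"]
  by (auto simp: irreducible_def degree_fract_poly)

text \<open>Neither condition implies the other: a constant atom becomes a unit over the quotient
  field, and a polynomial irreducible there may have a nonunit constant factor.\<close>

definition K_irreducible :: "'a::idom poly \<Rightarrow> bool" where
  "K_irreducible p \<longleftrightarrow> irreducible p \<and> irreducible (map_poly to_fract p)"

text \<open>Some atom \<open>p\<close> in a factorization of \<open>f\<close> has positive degree.
  By irreducibility over the quotient field, the product of the other atoms is a unit there, hence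
  constant.\<close>

lemma K_irreducible_multiple:
  fixes f :: "'a::idom poly"
  assumes at: "atomic_domain TYPE('a poly)" and irr: "irreducible (map_poly to_fract f)"
  obtains c p where "c \<noteq> 0" "K_irreducible p" "f = smult c p"
proof -
  have deg: "degree f > 0"
    using irr by (rule irreducible_fract_poly_degree_pos)
  then have "f \<noteq> 0" "\<not> f dvd 1"
    by (auto simp: is_unit_poly_iff)
  then obtain F where F: "\<forall>a\<in>#F. irreducible a" "prod_mset F = f"
    using at by (auto simp: atomic_domain_def atomic_factorization_def)
  have "\<exists>p\<in>#F. degree p > 0"
  proof (rule ccontr)
    assume "\<not> ?thesis"
    then have "degree (prod_mset F) = 0"
    proof (induction F)
      case (add p F)
      then have "degree p = 0" "degree (prod_mset F) = 0"
        by auto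
      then show ?case using degree_mult_le[of p "prod_mset F"]
        by (metis add_0 le_zero_eq prod_mset.add_mset)
    qed simp
    then show False using deg F by simp
  qed
  then obtain p G where p: "F = add_mset p G" "degree p > 0"
    by (metis multi_member_split)
  define g where "g = prod_mset G"
  have f: "f = p * g"
    using F p g_def by auto
  have "map_poly to_fract p dvd 1 \<or> map_poly to_fract g dvd 1"
    using irreducibleD[OF irr, of "map_poly to_fract p" "map_poly to_fract g"] f by simp
  moreover have "\<not> map_poly to_fract p dvd 1"
  proof -
    have "map_poly to_fract p \<noteq> 0"
      using p by auto
    then show ?thesis
      using p by (simp add: is_unit_iff_degree degree_fract_poly)
  qed
  ultimately have g_unit: "map_poly to_fract g dvd 1" by simp
  then have "degree g = 0"
    by (metis degree_fract_poly is_unit_iff_degree dvd_0_left zero_neq_one)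
  then obtain c where c: "g = [:c:]"
    by (auto elim: degree_eq_zeroE)
  have "irreducible (map_poly to_fract p)"
    using irr g_unit unfolding f
    by (simp add: mult.commute[of "map_poly to_fract p"] irreducible_mult_unit_left)
  then have "K_irreducible p"
    using F p by (simp add: K_irreducible_def)
  moreover have "c \<noteq> 0" "f = smult c p"
    using f c \<open>f \<noteq> 0\<close> by auto
  ultimately show ?thesis using that by blast
qed

lemma K_irreducible_factorization:
  fixes f :: "'a::idom poly"
  assumes at: "atomic_domain TYPE('a poly)" and "f \<noteq> 0"
  shows "\<exists>d c P. d \<noteq> 0 \<and> c \<noteq> 0 \<and> (\<forall>p\<in>#P. K_irreducible p) \<and>
           smult d f = smult c (prod_mset P)"
  using \<open>f \<noteq> 0\<close>
proof (induction "degree f" arbitrary: f rule: less_induct)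
  case less
  consider "degree f = 0" | "irreducible (map_poly to_fract f)"
    | "degree f > 0" "\<not> irreducible (map_poly to_fract f)"
    by blast
  then show ?case
  proof cases
    case 1
    then obtain c where "f = [:c:]"
      by (auto elim: degree_eq_zeroE)
    then show ?thesis
      using less.prems by (intro exI[of _ 1] exI[of _ c] exI[of _ "{#}"]) auto
  next
    case 2
    then obtain c p where "c \<noteq> 0" "K_irreducible p" "f = smult c p"
      using K_irreducible_multiple[OF at] by blast
    then show ?thesis
      by (intro exI[of _ 1] exI[of _ c] exI[of _ "{#p#}"]) auto
  next
    case 3
    have nz: "map_poly to_fract f \<noteq> 0"
      using less.prems by simp
    moreover have "\<not> map_poly to_fract f dvd 1"
      using 3 nz by (simp add: is_unit_iff_degree degree_fract_poly)
    ultimately obtain r s where rs: "map_poly to_fract f = r * s" "\<not> r dvd 1" "\<not> s dvd 1"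
      using 3 irreducibleI by blast
    then have rs0: "r \<noteq> 0" "s \<noteq> 0"
      using nz by auto
    obtain d g where g: "d \<noteq> 0" "smult (to_fract d) r = map_poly to_fract g"
      by (rule smult_fract_poly_clear_denominators)
    obtain e h where h: "e \<noteq> 0" "smult (to_fract e) s = map_poly to_fract h"
      by (rule smult_fract_poly_clear_denominators)
    \<comment> \<open>Clearing denominators turns the splitting \<open>r * s\<close> over the
      quotient field into one over the domain, with the same positive degrees.\<close>
    have "map_poly to_fract (smult (d * e) f) = map_poly to_fract (g * h)"
      by (simp add: rs(1) g(2)[symmetric] h(2)[symmetric] mult_ac)
    then have f_eq: "smult (d * e) f = g * h"
      by (simp only: fract_poly_eq_iff)
    then have gh0: "g \<noteq> 0" "h \<noteq> 0"
      using less.prems g h by auto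
    have "degree g = degree r" "degree h = degree s"
      using g h by (metis degree_fract_poly degree_smult_eq to_fract_eq_0_iff)+
    then have "degree g > 0" "degree h > 0"
      using rs rs0 by (auto simp: is_unit_iff_degree)
    moreover have "degree f = degree g + degree h"
      using f_eq gh0 g h by (metis degree_mult_eq degree_smult_eq mult_eq_0_iff)
    ultimately have "degree g < degree f" "degree h < degree f"
      by auto
    then obtain d1 c1 P1 d2 c2 P2 where
      1: "d1 \<noteq> 0" "c1 \<noteq> 0" "\<forall>p\<in>#P1. K_irreducible p" "smult d1 g = smult c1 (prod_mset P1)" and
      2: "d2 \<noteq> 0" "c2 \<noteq> 0" "\<forall>p\<in>#P2. K_irreducible p" "smult d2 h = smult c2 (prod_mset P2)"
      using less.hyps[of g] less.hyps[of h] gh0 by blast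
    have "smult (d1 * d2 * (d * e)) f = smult (d1 * d2) (g * h)"
      by (simp flip: f_eq)
    also have "\<dots> = smult d1 g * smult d2 h"
      by (simp add: mult.commute)
    also have "\<dots> = smult (c1 * c2) (prod_mset (P1 + P2))"
      using 1 2 by (simp add: mult_ac)
    finally show ?thesis
      using 1 2 g h
      by (intro exI[of _ "d1 * d2 * (d * e)"] exI[of _ "c1 * c2"] exI[of _ "P1 + P2"]) auto
  qed
qed

section \<open>Comparison of factorizations over the quotient field\<close>

text \<open>Over the quotient field \<open>p\<close> is prime, so it divides some \<open>q\<close>
  there. As \<open>q\<close> is irreducible there too, the quotient is a nonzero fraction, whose
  numerator and denominator are \<open>c'\<close> and \<open>c\<close>.\<close>

lemma K_irreducible_dvd_prod_mset:
  fixes p :: "'a::idom poly"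
  assumes "K_irreducible p" "\<forall>q\<in>#Q. K_irreducible q" "b \<noteq> 0"
    "p dvd smult b (prod_mset Q)"
  obtains q c c' where "q \<in># Q" "c \<noteq> 0" "c' \<noteq> 0" "smult c q = smult c' p"
proof -
  define \<phi> where "\<phi> = (map_poly to_fract :: 'a poly \<Rightarrow> 'a fract poly)"
  have prime: "prime_elem (\<phi> p)"
    using assms(1) by (simp add: K_irreducible_def \<phi>_def field_poly_irreducible_imp_prime)
  have "\<phi> p dvd smult (to_fract b) (\<phi> (prod_mset Q))"
    using fract_poly_dvd[OF assms(4)] by (simp add: \<phi>_def)
  then have "\<phi> p dvd \<phi> (prod_mset Q)"
    using assms(3) by (simp add: dvd_smult_iff)
  also have "\<phi> (prod_mset Q) = prod_mset (image_mset \<phi> Q)"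
    using prod_mset_fract_poly[of "\<lambda>x. x" Q] by (simp add: \<phi>_def)
  finally obtain y where "y \<in># image_mset \<phi> Q" "\<phi> p dvd y"
    by (rule prime_elem_dvd_prod_msetE[OF prime])
  then obtain q where q: "q \<in># Q" "\<phi> p dvd \<phi> q"
    by auto
  obtain r where r: "\<phi> q = \<phi> p * r"
    using q(2) by (rule dvdE)
  have irr: "irreducible (\<phi> q)"
    using assms(2) q(1) by (simp add: K_irreducible_def \<phi>_def)
  have "\<not> \<phi> p dvd 1"
    using prime by (simp add: prime_elem_def)
  then have "r dvd 1"
    using irreducibleD[OF irr r] by simp
  then obtain x where "r = [:x:]" "x dvd 1"
    by (rule is_unit_polyE)
  then have x: "r = [:x:]" "x \<noteq> 0"
    by auto
  obtain a b where ab: "x = Fract a b" "b \<noteq> 0"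
    by (cases x)
  have "a \<noteq> 0"
    using x ab by (auto simp: Fract_conv_to_fract)
  moreover have "map_poly to_fract (smult b q) = map_poly to_fract (smult a p)"
    using r x ab by (simp add: \<phi>_def Fract_conv_to_fract)
  then have "smult b q = smult a p"
    by (simp only: fract_poly_eq_iff)
  ultimately show ?thesis
    using that q(1) ab(2) by blast
qed

text \<open>Induction on \<open>P\<close>: some \<open>q\<close> in \<open>Q\<close> is a constant
  multiple of \<open>p\<close> over the quotient field, and cancelling this pair changes both counts
  equally.\<close>

lemma K_irreducible_length_unique:
  fixes P Q :: "'a::idom poly multiset"
  assumes hfd: "half_factorial_domain TYPE('a)"
    and good: "\<And>a::'a. irreducible a \<Longrightarrow> good_atom [:a:]"
    and "\<forall>p\<in>#P. K_irreducible p" "\<forall>q\<in>#Q. K_irreducible q" "a \<noteq> 0" "b \<noteq> 0"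
    "smult a (prod_mset P) = smult b (prod_mset Q)"
  shows "flen a + size P = flen b + size Q"
  using assms(3-)
proof (induction P arbitrary: Q a b)
  case empty
  have "Q = {#}"
  proof (rule ccontr)
    assume "Q \<noteq> {#}"
    then obtain q R where Q: "Q = add_mset q R"
      by (meson multiset_cases)
    then have "q dvd [:a:]"
      using empty.prems(5) by (metis dvd_triv_left dvd_smult prod_mset.add_mset prod_mset_empty
        smult_one)
    then have "degree q = 0"
      using empty.prems(3) dvd_imp_degree_le[of q "[:a:]"] by simp
    moreover have "degree q > 0"
      using empty.prems(2) Q by (auto simp: K_irreducible_def intro: irreducible_fract_poly_degree_pos)
    ultimately show False by simp
  qed
  then show ?case using empty by simp
next
  case (add p P)
  have p: "K_irreducible p"
    using add.prems by simp
  have "p dvd smult b (prod_mset Q)"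
    unfolding add.prems(5)[symmetric] by (simp add: dvd_smult)
  then obtain q c c' where q: "q \<in># Q" "c \<noteq> 0" "c' \<noteq> 0" "smult c q = smult c' p"
    using K_irreducible_dvd_prod_mset[OF p add.prems(2,4)] by metis
  obtain R where Q: "Q = add_mset q R"
    using q(1) by (metis multi_member_split)
  have p0: "p \<noteq> 0"
    using p by (auto simp: K_irreducible_def irreducible_def)
  \<comment> \<open>One atom stands on each side of \<open>smult c q = smult c' p\<close>, so
    \<open>c\<close> and \<open>c'\<close> have equal lengths.\<close>
  have "flen c + 1 = flen c' + size {#p#}"
    using q p add.prems(2) by (intro length_smult_irreducible[OF hfd good]) (auto simp: K_irreducible_def)
  then have len: "flen c = flen c'"
    by simp
  have "p * smult (c * a) (prod_mset P) = smult c (smult b (prod_mset Q))"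
    unfolding add.prems(5)[symmetric] by simp
  also have "\<dots> = smult b (smult c q * prod_mset R)"
    unfolding Q by (simp add: mult.commute)
  also have "\<dots> = p * smult (c' * b) (prod_mset R)"
    unfolding q(4) by (simp add: mult.commute)
  finally have "smult (c * a) (prod_mset P) = smult (c' * b) (prod_mset R)"
    using p0 by (metis mult_left_cancel)
  then have "flen (c * a) + size P = flen (c' * b) + size R"
    using add.prems q Q by (intro add.IH) auto
  then show ?case
    using len add.prems q Q by (simp add: flen_mult[OF hfd])
qed

text \<open>The quantity \<open>flen c + size P - flen d\<close> adds up over the factors and is 1
  for each atom, so it counts the atoms in \<open>F\<close>. The equation avoids subtraction of
  natural numbers.\<close>

lemma prod_mset_K_irreducible_factorization:
  fixes F :: "'a::idom poly multiset"
  assumes hfd: "half_factorial_domain TYPE('a)"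
    and good: "\<And>a::'a. irreducible a \<Longrightarrow> good_atom [:a:]"
    and "\<forall>f\<in>#F. irreducible f"
  shows "\<exists>d c P. d \<noteq> 0 \<and> c \<noteq> 0 \<and> (\<forall>p\<in>#P. K_irreducible p) \<and>
           smult d (prod_mset F) = smult c (prod_mset P) \<and> flen d + size F = flen c + size P"
  using assms(3)
proof (induction F)
  case empty
  show ?case by (intro exI[of _ 1] exI[of _ "{#}"]) auto
next
  case (add f F)
  then obtain d c P where 1: "d \<noteq> 0" "c \<noteq> 0" "\<forall>p\<in>#P. K_irreducible p"
    "smult d (prod_mset F) = smult c (prod_mset P)" "flen d + size F = flen c + size P"
    by auto
  have f: "irreducible f"
    using add.prems by simp
  then have "f \<noteq> 0"
    by (simp add: irreducible_def)
  then obtain e b Q where 2: "e \<noteq> 0" "b \<noteq> 0" "\<forall>q\<in>#Q. K_irreducible q"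
    "smult e f = smult b (prod_mset Q)"
    using K_irreducible_factorization[OF HFD_imp_atomic_poly[OF hfd]] by blast
  have "flen e + 1 = flen b + size Q"
    using f 2 by (intro length_smult_irreducible[OF hfd good]) (auto simp: K_irreducible_def)
  then have "flen (e * d) + size (add_mset f F) = flen (b * c) + size (Q + P)"
    using 1 2 by (simp add: flen_mult[OF hfd])
  moreover have "smult (e * d) (prod_mset (add_mset f F)) = smult e f * smult d (prod_mset F)"
    by (simp add: mult.commute)
  then have "smult (e * d) (prod_mset (add_mset f F)) = smult (b * c) (prod_mset (Q + P))"
    unfolding 1(4) 2(4) by (simp add: mult.commute)
  ultimately show ?case
    using 1 2 by (intro exI[of _ "e * d"] exI[of _ "b * c"] exI[of _ "Q + P"]) auto
qed

theorem corollary10: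
  assumes "half_factorial_domain TYPE('a::idom)"
    and "\<And>a::'a. irreducible a \<Longrightarrow> good_atom [:a:]"
  shows "half_factorial_domain TYPE('a poly)"
proof -
  have "size F = size G"
    if F: "atomic_factorization F x" and G: "atomic_factorization G x" for x :: "'a poly" and F G
  proof -
    have F': "\<forall>f\<in>#F. irreducible f" "prod_mset F = x"
      and G': "\<forall>f\<in>#G. irreducible f" "prod_mset G = x"
      using F G by (simp_all add: atomic_factorization_def)
    obtain d c P where 1: "d \<noteq> 0" "c \<noteq> 0" "\<forall>p\<in>#P. K_irreducible p"
      "smult d x = smult c (prod_mset P)" "flen d + size F = flen c + size P"
      using prod_mset_K_irreducible_factorization[OF assms F'(1)] unfolding F'(2) by blast
    obtain e b Q where 2: "e \<noteq> 0" "b \<noteq> 0" "\<forall>q\<in>#Q. K_irreducible q"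
      "smult e x = smult b (prod_mset Q)" "flen e + size G = flen b + size Q"
      using prod_mset_K_irreducible_factorization[OF assms G'(1)] unfolding G'(2) by blast
    \<comment> \<open>Multiplying by both denominators makes the two expressions for
      \<open>x\<close> comparable; afterwards all \<open>flen\<close> terms cancel.\<close>
    have "smult (e * c) (prod_mset P) = smult e (smult d x)"
      by (simp add: 1(4))
    also have "\<dots> = smult d (smult e x)"
      by (simp add: mult.commute)
    also have "\<dots> = smult (d * b) (prod_mset Q)"
      by (simp add: 2(4))
    finally have "flen (e * c) + size P = flen (d * b) + size Q"
      using 1 2 by (intro K_irreducible_length_unique[OF assms]) auto
    then show ?thesis
      using 1 2 by (simp add: flen_mult[OF assms(1)])
  qed
  then show ?thesis
    using HFD_imp_atomic_poly[OF assms(1)] unfolding half_factorial_domain_def by blast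
qed

end
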